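(* Let $(X,\rho)$ be a complete $b_v(s)$-metric space, where $v\in\mathbb{N}$ and $s\in[1,\infty)$. Let $T:X\to X$ be an orbitally continuous map such that $$\rho(Tx,Ty)<\max\big\{\rho(x,y),\ \rho(x,Tx),\ \rho(y,Ty)\big\}$$ for all $x,y\in X$ with $x\neq y$. Furthermore, assume that for any $x\in X$ and any $\varepsilon>0$ there exist $\delta>0$ and $N\in\mathbb{N}$ such that for all $n,m\in\mathbb{N}$ with $n,m\ge N$, $$\rho(T^nx,T^mx)<s^2\varepsilon+\delta\ \Longrightarrow\ \rho(T^{n+1}x,T^{m+1}x)\le\varepsilon.$$ Then $T$ has a unique fixed point $u\in X$, and for every $x\in X$ the Picard iterative sequence $\{T^n x\}$ converges to $u$.
   Context: Let $X$ be a non-empty set, $v\in\mathbb{N}$ and $s\in[1,\infty)$. A function $\rho:X\times X\to\mathbb{R}$ is a $b_v(s)$-metric, and $(X,\rho)$ is a $b_v(s)$-metric space, if for all $x,y\in X$ and for all distinct points $u_1,\dots,u_v\in X$, each of them different from $x$ and $y$: (i) $\rho(x,y)\ge 0$, and $\rho(x,y)=0$ if and only if $x=y$; (ii) $\rho(x,y)=\rho(y,x)$; (iii) $\rho(x,y)\le s\left[\rho(x,u_1)+\rho(u_1,u_2)+\cdots+\rho(u_v,y)\right]$. A sequence $\{x_n\}$ in $X$ converges to $x\in X$ if $\rho(x_n,x)\to 0$ as $n\to\infty$; it is Cauchy if $\rho(x_n,x_m)\to 0$ as $n,m\to\infty$. The space $(X,\rho)$ is complete if every Cauchy sequence in $X$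 converges to some point of $X$. A map $T:X\to X$ is orbitally continuous if, whenever $x,z\in X$ and $\{n_k\}$ is a strictly increasing sequence of natural numbers with $T^{n_k}x\to z$ as $k\to\infty$, one has $T(T^{n_k}x)\to Tz$ as $k\to\infty$. *)

theory Defs
  imports Complex_Main
begin

text \<open>
  The carrier is a set \<open>X\<close>; values of \<open>\<rho>\<close> outside \<open>X\<close> are irrelevant.
  The parameter \<open>v\<close> is a positive integer: for \<open>v = 0\<close> there would be no
  intermediate points and the polygon inequality would be void.
\<close>

definition bvs_metric_space :: "'a set \<Rightarrow> ('a \<Rightarrow> 'a \<Rightarrow> real) \<Rightarrow> nat \<Rightarrow> real \<Rightarrow> bool" where
  "bvs_metric_space X \<rho> v s \<longleftrightarrow>
     X \<noteq> {} \<and> v \<ge> 1 \<and> s \<ge> 1 \<and>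
     (\<forall>x\<in>X. \<forall>y\<in>X. \<rho> x y \<ge> 0 \<and> (\<rho> x y = 0 \<longleftrightarrow> x = y)) \<and>
     (\<forall>x\<in>X. \<forall>y\<in>X. \<rho> x y = \<rho> y x) \<and>
     (\<forall>x\<in>X. \<forall>y\<in>X. \<forall>u :: nat \<Rightarrow> 'a.
        u ` {1..v} \<subseteq> X - {x, y} \<and> inj_on u {1..v} \<longrightarrow>
        \<rho> x y \<le> s * (\<rho> x (u 1) + (\<Sum>i\<in>{1..<v}. \<rho> (u i) (u (i + 1))) + \<rho> (u v) y))"

definition bvs_converges :: "('a \<Rightarrow> 'a \<Rightarrow> real) \<Rightarrow> (nat \<Rightarrow> 'a) \<Rightarrow> 'a \<Rightarrow> bool" where
  "bvs_converges \<rho> f x \<longleftrightarrow> (\<lambda>n. \<rho> (f n) x) \<longlonglongrightarrow> 0"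

definition bvs_Cauchy :: "('a \<Rightarrow> 'a \<Rightarrow> real) \<Rightarrow> (nat \<Rightarrow> 'a) \<Rightarrow> bool" where
  "bvs_Cauchy \<rho> f \<longleftrightarrow>
     ((\<lambda>(n, m). \<rho> (f n) (f m)) \<longlongrightarrow> 0) (sequentially \<times>\<^sub>F sequentially)"

definition bvs_complete :: "'a set \<Rightarrow> ('a \<Rightarrow> 'a \<Rightarrow> real) \<Rightarrow> bool" where
  "bvs_complete X \<rho> \<longleftrightarrow>
     (\<forall>f. range f \<subseteq> X \<and> bvs_Cauchy \<rho> f \<longrightarrow> (\<exists>x\<in>X. bvs_converges \<rho> f x))"

definition orbitally_continuous ::
    "'a set \<Rightarrow> ('a \<Rightarrow> 'a \<Rightarrow> real) \<Rightarrow> ('a \<Rightarrow> 'a) \<Rightarrow> bool" where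
  "orbitally_continuous X \<rho> T \<longleftrightarrow>
     (\<forall>x\<in>X. \<forall>z\<in>X. \<forall>r :: nat \<Rightarrow> nat.
        strict_mono r \<and> bvs_converges \<rho> (\<lambda>k. (T ^^ r k) x) z \<longrightarrow>
        bvs_converges \<rho> (\<lambda>k. T ((T ^^ r k) x)) (T z))"

end

theory Submission
  imports Defs
begin

text \<open>
  Fix \<open>x\<close> and write \<open>a n\<close> for \<open>T^n x\<close>. If the orbit reaches a fixed point, it is
  eventually constant. Otherwise the contractive condition makes the step lengths
  \<open>\<rho> (a n) (a (n + 1))\<close> strictly decreasing, so the points \<open>a n\<close> are pairwise distinct
  and any \<open>v\<close> of them may serve as the corners of a polygon.

  For a fixed gap \<open>j\<close> the larger of \<open>\<rho> (a n) (a (n + j))\<close> and \<open>\<rho> (a n) (a (n + 1))\<close>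
  also strictly decreases in \<open>n\<close>. A positive limit \<open>L\<close> contradicts the Meir-Keeler condition
  for \<open>\<epsilon> = L\<close>, which would push the sequence down to \<open>L\<close> itself. Hence every fixed gap
  closes asymptotically (\<open>gap_tendsto_0\<close>).

  To control all gaps at once, note that the Meir-Keeler condition turns
  \<open>\<rho> (a n) (a m) < s\<^sup>2 * \<epsilon> + \<delta>\<close> into \<open>\<rho> (a (n + 1)) (a (m + 1)) \<le> \<epsilon>\<close>, and the polygon
  \<open>a n, a (n + 1), a (m + 1), a (m + 2), ..., a (m + v)\<close> has exactly \<open>v\<close> inner corners and,
  besides that one side of length at most \<open>\<epsilon>\<close>, only short sides. So the first bound passes
  from \<open>m\<close> to \<open>m + v\<close>. Every \<open>m > n\<close> is reached in this way from one of the gaps \<open>1, ..., v\<close>,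
  all of which are eventually small; the orbit is therefore Cauchy (\<open>orbit_Cauchy\<close>).

  In a \<open>b\<^sub>v(s)\<close>-metric space limits need not be unique, but a sequence of distinct points
  with vanishing steps has at most one limit (\<open>limit_unique\<close>). By orbital continuity the
  limit \<open>u\<close> of the orbit and \<open>T u\<close> are both limits of the same shifted orbit, so \<open>T u = u\<close>. The
  contractive condition excludes a second fixed point, so all orbits share this limit.
\<close>

section \<open>Polygons and limits in \<open>b\<^sub>v(s)\<close>-metric spaces\<close>

lemma bvs_polygon:
  assumes "bvs_metric_space X \<rho> v s" and "w ` {..Suc v} \<subseteq> X" and "inj_on w {..Suc v}"
  shows "\<rho> (w 0) (w (Suc v)) \<le> s * (\<Sum>i\<le>v. \<rho> (w i) (w (Suc i)))"
proof -
  have v: "v \<ge> 1" using assms(1) by (simp add: bvs_metric_space_def)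
  have "w ` {1..v} \<subseteq> X - {w 0, w (Suc v)}"
    using assms(2) inj_onD[OF assms(3)] by force
  moreover have "inj_on w {1..v}"
    using assms(3) by (rule inj_on_subset) auto
  moreover have "w 0 \<in> X" "w (Suc v) \<in> X" using assms(2) by auto
  ultimately have "\<rho> (w 0) (w (Suc v)) \<le>
      s * (\<rho> (w 0) (w 1) + (\<Sum>i\<in>{1..<v}. \<rho> (w i) (w (i + 1))) + \<rho> (w v) (w (Suc v)))"
    using assms(1) unfolding bvs_metric_space_def by blast
  moreover have "(\<Sum>i\<le>v. \<rho> (w i) (w (Suc i))) =
      \<rho> (w 0) (w 1) + (\<Sum>i\<in>{1..<v}. \<rho> (w i) (w (i + 1))) + \<rho> (w v) (w (Suc v))"
  proof -
    have "{..v} = insert 0 (insert v {1..<v})" using v by auto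
    then show ?thesis using v by simp
  qed
  ultimately show ?thesis by simp
qed

text \<open>
  Distinctness of the sequence matters: the polygon from one limit to the other needs inner
  corners that differ from each other and from both limits.
\<close>
lemma limit_unique:
  assumes space: "bvs_metric_space X \<rho> v s"
    and a: "range a \<subseteq> X" "inj a"
    and steps: "(\<lambda>n. \<rho> (a n) (a (Suc n))) \<longlonglongrightarrow> 0"
    and lim: "bvs_converges \<rho> a p" "bvs_converges \<rho> a q" and pq: "p \<in> X" "q \<in> X"
  shows "p = q"
proof (rule ccontr)
  assume "p \<noteq> q"
  have v: "v \<ge> 1" and sym: "\<And>x y. x \<in> X \<Longrightarrow> y \<in> X \<Longrightarrow> \<rho> x y = \<rho> y x"
    and pos: "\<rho> p q \<ge> 0" "\<rho> p q = 0 \<longleftrightarrow> p = q"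
    using space pq by (auto simp: bvs_metric_space_def)
  define w where "w n i = (if i = 0 then p else if i = Suc v then q else a (n + i))" for n i
  have "(\<lambda>n. s * (\<Sum>i\<le>v. \<rho> (w n i) (w n (Suc i)))) \<longlonglongrightarrow> s * (\<Sum>i\<le>v. 0)"
  proof (intro tendsto_intros)
    fix i assume i: "i \<in> {..v}"
    consider "i = 0" | "0 < i" "i < v" | "i = v" using i by force
    then show "(\<lambda>n. \<rho> (w n i) (w n (Suc i))) \<longlonglongrightarrow> 0"
    proof cases
      case 1
      have "(\<lambda>n. \<rho> (a (n + 1)) p) \<longlonglongrightarrow> 0"
        using lim(1) LIMSEQ_ignore_initial_segment unfolding bvs_converges_def by blast
      moreover have "\<rho> (w n i) (w n (Suc i)) = \<rho> (a (n + 1)) p" for n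
        using 1 v sym[of p "a (n + 1)"] pq a(1) by (auto simp: w_def)
      ultimately show ?thesis by simp
    next
      case 2
      have "(\<lambda>n. \<rho> (a (n + i)) (a (Suc (n + i)))) \<longlonglongrightarrow> 0"
        using LIMSEQ_ignore_initial_segment[OF steps] .
      then show ?thesis using 2 by (simp add: w_def)
    next
      case 3
      have "(\<lambda>n. \<rho> (a (n + v)) q) \<longlonglongrightarrow> 0"
        using lim(2) LIMSEQ_ignore_initial_segment unfolding bvs_converges_def by blast
      then show ?thesis using 3 v by (simp add: w_def)
    qed
  qed
  moreover have "\<forall>\<^sub>F n in sequentially. \<rho> p q \<le> s * (\<Sum>i\<le>v. \<rho> (w n i) (w n (Suc i)))"
  proof -
    \<comment> \<open>By injectivity the sequence visits each of the two limits at most once.\<close>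
    have avoid: "\<forall>\<^sub>F n in sequentially. \<forall>m\<ge>n. a m \<noteq> r" for r
    proof (cases "r \<in> range a")
      case True
      then obtain k where "r = a k" by auto
      then have "\<forall>m\<ge>n. a m \<noteq> r" if "n \<ge> Suc k" for n
        using that a(2) by (auto dest: injD)
      then show ?thesis unfolding eventually_sequentially by blast
    next
      case False
      then have "a m \<noteq> r" for m by blast
      then show ?thesis by simp
    qed
    show ?thesis
      using avoid[of p] avoid[of q]
    proof eventually_elim
      case (elim n)
      have "inj_on (w n) {..Suc v}"
      proof (rule inj_onI)
        fix i j assume "w n i = w n j"
        then show "i = j"
          using elim[rule_format, of "n + i"] elim[rule_format, of "n + j"] \<open>p \<noteq> q\<close>
          by (auto simp: w_def injD[OF a(2)] inj_eq[OF a(2)] split: if_splits)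
      qed
      moreover have "w n ` {..Suc v} \<subseteq> X" using a(1) pq by (auto simp: w_def)
      ultimately show ?case using bvs_polygon[OF space, of "w n"] by (simp add: w_def)
    qed
  qed
  ultimately have "\<rho> p q \<le> 0"
    using tendsto_lowerbound by fastforce
  then show False using pos \<open>p \<noteq> q\<close> by linarith
qed

section \<open>Orbits without a fixed point\<close>

text \<open>
  A limit \<open>L > 0\<close> is never attained because of the strict decrease, yet the last hypothesis
  for \<open>\<epsilon> = L\<close> forces terms close to \<open>L\<close> to be followed by terms at most \<open>L\<close>.
\<close>
lemma strictly_decreasing_tendsto_0:
  fixes M :: "nat \<Rightarrow> real"
  assumes nonneg: "\<And>n. 0 \<le> M n" and less: "\<And>n. M (Suc n) < M n"
    and drop: "\<And>\<epsilon>. \<epsilon> > 0 \<Longrightarrow> \<exists>\<delta>>0. \<exists>N. \<forall>n\<ge>N. M n < \<epsilon> + \<delta> \<longrightarrow> M (Suc n) \<le> \<epsilon>"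
  shows "M \<longlonglongrightarrow> 0"
proof -
  have dec: "decseq M" using less by (intro decseq_SucI less_imp_le)
  obtain L where L: "M \<longlonglongrightarrow> L" "\<And>n. L \<le> M n"
    using decseq_convergent[OF dec, of 0] nonneg by blast
  have above: "L < M n" for n
    using L(2)[of "Suc n"] less[of n] by linarith
  have "L \<ge> 0" using LIMSEQ_le_const[OF L(1)] nonneg by blast
  have "L = 0"
  proof (rule ccontr)
    assume "L \<noteq> 0"
    then have "L > 0" using \<open>L \<ge> 0\<close> by simp
    then obtain \<delta> N where d: "\<delta> > 0" "\<forall>n\<ge>N. M n < L + \<delta> \<longrightarrow> M (Suc n) \<le> L"
      using drop by meson
    have "\<forall>\<^sub>F n in sequentially. M n < L + \<delta>"
      using order_tendstoD(2)[OF L(1)] d(1) by simp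
    then obtain n where "n \<ge> N" "M n < L + \<delta>"
      unfolding eventually_sequentially by (meson nle_le)
    then show False using d(2) above[of "Suc n"] by fastforce
  qed
  then show ?thesis using L(1) by simp
qed

locale moving_orbit =
  fixes X :: "'a set" and \<rho> :: "'a \<Rightarrow> 'a \<Rightarrow> real" and v :: nat and s :: real
    and T :: "'a \<Rightarrow> 'a" and x :: 'a
  assumes space: "bvs_metric_space X \<rho> v s"
    and self_map: "T ` X \<subseteq> X"
    and x: "x \<in> X"
    and contractive: "\<And>x y. x \<in> X \<Longrightarrow> y \<in> X \<Longrightarrow> x \<noteq> y \<Longrightarrow>
          \<rho> (T x) (T y) < Max {\<rho> x y, \<rho> x (T x), \<rho> y (T y)}"
    and meir_keeler: "\<And>\<epsilon>. \<epsilon> > 0 \<Longrightarrow>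
          \<exists>\<delta>>0. \<exists>N::nat. \<forall>n\<ge>N. \<forall>m\<ge>N.
            \<rho> ((T ^^ n) x) ((T ^^ m) x) < s\<^sup>2 * \<epsilon> + \<delta> \<longrightarrow>
            \<rho> ((T ^^ (n + 1)) x) ((T ^^ (m + 1)) x) \<le> \<epsilon>"
    and moving: "\<And>n. T ((T ^^ n) x) \<noteq> (T ^^ n) x"
begin

abbreviation a :: "nat \<Rightarrow> 'a" where "a n \<equiv> (T ^^ n) x"

lemma orbit_in: "a n \<in> X"
  using self_map x by (induction n) auto

lemma dist_nonneg: "\<rho> (a n) (a m) \<ge> 0"
  using space orbit_in by (auto simp: bvs_metric_space_def)

lemma s_ge_1: "s \<ge> 1" and v_ge_1: "v \<ge> 1"
  using space by (auto simp: bvs_metric_space_def)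

lemma step_less: "\<rho> (a (Suc n)) (a (Suc (Suc n))) < \<rho> (a n) (a (Suc n))"
  using contractive[OF orbit_in[of n] orbit_in[of "Suc n"]] moving[of n] by auto

lemma step_antimono: "n \<le> m \<Longrightarrow> \<rho> (a m) (a (Suc m)) \<le> \<rho> (a n) (a (Suc n))"
  by (rule lift_Suc_antimono_le[of "\<lambda>n. \<rho> (a n) (a (Suc n))"])
     (use step_less less_imp_le in blast)+

text \<open>A repetition would make the orbit periodic, but its step lengths strictly decrease.\<close>
lemma orbit_inj: "inj a"
proof (rule linorder_injI)
  fix n m :: nat assume "n < m"
  then have "\<rho> (a m) (a (Suc m)) < \<rho> (a n) (a (Suc n))"
    using step_antimono[of "Suc n" m] step_less[of n] by simp
  then show "a n \<noteq> a m" by auto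
qed

text \<open>
  Including the step length in the maximum makes the sequence strictly decreasing, since the
  contractive condition bounds the next distance by that maximum. The Meir-Keeler condition
  applies to both components at once.
\<close>
lemma gap_tendsto_0:
  assumes "j \<ge> 1"
  shows "(\<lambda>n. \<rho> (a n) (a (n + j))) \<longlonglongrightarrow> 0"
proof -
  define M where "M n = max (\<rho> (a n) (a (n + j))) (\<rho> (a n) (a (n + 1)))" for n
  have "M \<longlonglongrightarrow> 0"
  proof (rule strictly_decreasing_tendsto_0)
    fix n
    show "0 \<le> M n" using dist_nonneg[of n "n + 1"] by (simp add: M_def le_max_iff_disj)
    have "a n \<noteq> a (n + j)" using assms inj_eq[OF orbit_inj, of n "n + j"] by simp
    then have "\<rho> (a (Suc n)) (a (Suc n + j)) < M n"
      using contractive[OF orbit_in[of n] orbit_in[of "n + j"]] step_antimono[of n "n + j"]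
      by (auto simp: M_def less_max_iff_disj)
    then show "M (Suc n) < M n"
      using step_less[of n] by (auto simp: M_def less_max_iff_disj)
  next
    fix \<epsilon> :: real assume "\<epsilon> > 0"
    obtain \<delta> N where d: "\<delta> > 0" and mk: "\<forall>n\<ge>N. \<forall>m\<ge>N. \<rho> (a n) (a m) < s\<^sup>2 * \<epsilon> + \<delta> \<longrightarrow>
        \<rho> (a (n + 1)) (a (m + 1)) \<le> \<epsilon>"
      using meir_keeler[OF \<open>\<epsilon> > 0\<close>] by meson
    have "\<epsilon> \<le> s\<^sup>2 * \<epsilon>" using \<open>\<epsilon> > 0\<close> s_ge_1 by simp
    have "M (Suc n) \<le> \<epsilon>" if "n \<ge> N" "M n < \<epsilon> + \<delta>" for n
      using mk[rule_format, of n "n + j"] mk[rule_format, of n "n + 1"] that \<open>\<epsilon> \<le> s\<^sup>2 * \<epsilon>\<close>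
      by (auto simp: M_def)
    then show "\<exists>\<delta>>0. \<exists>N. \<forall>n\<ge>N. M n < \<epsilon> + \<delta> \<longrightarrow> M (Suc n) \<le> \<epsilon>"
      using d by blast
  qed
  then show ?thesis
    by (rule tendsto_sandwich[OF _ _ tendsto_const, rotated 2])
       (auto simp: M_def dist_nonneg)
qed

text \<open>
  One polygon step along the orbit: the side from \<open>a (n + 1)\<close> to \<open>a (m + 1)\<close> is the only one
  that is not a step of the orbit. The factor \<open>s\<close> of the polygon inequality multiplies \<open>\<epsilon>\<close>,
  which the constant \<open>s\<^sup>2\<close> of the Meir-Keeler condition absorbs.
\<close>
lemma gap_advance:
  fixes \<epsilon> \<eta> :: real
  assumes "n < m" and "\<rho> (a (n + 1)) (a (m + 1)) \<le> \<epsilon>"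
    and steps: "\<And>k. k \<ge> n \<Longrightarrow> \<rho> (a k) (a (k + 1)) \<le> \<eta>"
  shows "\<rho> (a n) (a (m + v)) \<le> s * (\<epsilon> + v * \<eta>)"
proof -
  define k where "k i = (if i \<le> 1 then n + i else m + i - 1)" for i
  have "strict_mono k" using \<open>n < m\<close> by (auto simp: strict_mono_Suc_iff k_def)
  then have "inj (\<lambda>i. a (k i))"
    using inj_compose[OF orbit_inj strict_mono_imp_inj_on] by (simp add: o_def)
  then have "\<rho> (a (k 0)) (a (k (Suc v))) \<le> s * (\<Sum>i\<le>v. \<rho> (a (k i)) (a (k (Suc i))))"
    using orbit_in by (intro bvs_polygon[OF space]) (auto intro: inj_on_subset)
  also have "(\<Sum>i\<le>v. \<rho> (a (k i)) (a (k (Suc i)))) =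
      \<rho> (a (k 1)) (a (k 2)) + (\<Sum>i\<in>{..v} - {1}. \<rho> (a (k i)) (a (k (Suc i))))"
    using v_ge_1 by (subst sum.remove[of _ 1]) (auto simp: numeral_2_eq_2)
  also have "\<dots> \<le> \<epsilon> + of_nat (card ({..v} - {1})) * \<eta>"
  proof (intro add_mono sum_bounded_above)
    show "\<rho> (a (k 1)) (a (k 2)) \<le> \<epsilon>" using assms(2) by (simp add: k_def)
    fix i assume i: "i \<in> {..v} - {1}"
    then have "k (Suc i) = k i + 1" "k i \<ge> n" using \<open>n < m\<close> by (auto simp: k_def)
    then show "\<rho> (a (k i)) (a (k (Suc i))) \<le> \<eta>" using steps by simp
  qed
  also have "card ({..v} - {1}) = v" using v_ge_1 by simp
  finally show ?thesis using s_ge_1 v_ge_1 by (simp add: k_def)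
qed

lemma orbit_uniformly_close:
  assumes "\<epsilon> > 0"
  shows "\<exists>K. \<forall>n\<ge>K. \<forall>m>n. \<rho> (a n) (a m) \<le> \<epsilon>"
proof -
  obtain \<delta> N where d: "\<delta> > 0" and mk: "\<forall>n\<ge>N. \<forall>m\<ge>N. \<rho> (a n) (a m) < s\<^sup>2 * \<epsilon> + \<delta> \<longrightarrow>
      \<rho> (a (n + 1)) (a (m + 1)) \<le> \<epsilon>"
    using meir_keeler[OF assms] by meson
  \<comment> \<open>Chosen so that \<open>v\<close> short sides, inflated by \<open>s\<close>, stay strictly below \<open>\<delta>\<close>.\<close>
  define \<eta> where "\<eta> = \<delta> / (2 * s * v)"
  have sv: "s * v \<ge> 1" using s_ge_1 v_ge_1 mult_mono[of 1 s 1 "real v"] by simp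
  have \<eta>: "\<eta> > 0" "s * v * \<eta> < \<delta>" "\<eta> < \<delta>"
    using d sv s_ge_1 v_ge_1 by (auto simp: \<eta>_def field_simps)
  have "\<forall>\<^sub>F n in sequentially. \<forall>j\<in>{1..v}. \<rho> (a n) (a (n + j)) < \<eta>"
    using order_tendstoD(2)[OF gap_tendsto_0] \<eta>(1) by (intro eventually_ball_finite) auto
  then obtain N' where N': "\<And>n j. n \<ge> N' \<Longrightarrow> j \<in> {1..v} \<Longrightarrow> \<rho> (a n) (a (n + j)) < \<eta>"
    unfolding eventually_sequentially by blast
  define K where "K = max N N'"
  have close: "\<rho> (a n) (a (n + j)) < s\<^sup>2 * \<epsilon> + \<delta>" if "n \<ge> K" "j \<ge> 1" for n j
    using that(2)
  proof (induction j rule: less_induct)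
    case (less j)
    show ?case
    proof (cases "j \<le> v")
      case True
      then show ?thesis using N'[of n j] less.prems \<open>n \<ge> K\<close> \<eta>(3) assms zero_le_power2[of s]
        by (smt (verit) K_def atLeastAtMost_iff max.bounded_iff mult_nonneg_nonneg)
    next
      case False
      define m where "m = n + (j - v)"
      have "\<rho> (a n) (a m) < s\<^sup>2 * \<epsilon> + \<delta>"
        using less.IH[of "j - v"] False v_ge_1 by (simp add: m_def)
      moreover have "n \<ge> N" "m \<ge> N" using \<open>n \<ge> K\<close> by (auto simp: K_def m_def)
      ultimately have "\<rho> (a (n + 1)) (a (m + 1)) \<le> \<epsilon>" using mk by blast
      moreover have "\<rho> (a k) (a (k + 1)) \<le> \<eta>" if "k \<ge> n" for k
        using N'[of k 1] that \<open>n \<ge> K\<close> v_ge_1 by (simp add: K_def)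
      ultimately have "\<rho> (a n) (a (m + v)) \<le> s * (\<epsilon> + v * \<eta>)"
        using False by (intro gap_advance) (auto simp: m_def)
      also have "\<dots> = s * \<epsilon> + s * v * \<eta>" by (simp add: algebra_simps)
      also have "\<dots> < s\<^sup>2 * \<epsilon> + \<delta>"
      proof -
        have "s * \<epsilon> \<le> s\<^sup>2 * \<epsilon>"
          using assms s_ge_1 by (intro mult_right_mono self_le_power) auto
        then show ?thesis using \<eta>(2) by linarith
      qed
      finally show ?thesis using False by (simp add: m_def)
    qed
  qed
  have "\<rho> (a n) (a m) \<le> \<epsilon>" if "n \<ge> Suc K" "m > n" for n m
  proof -
    have "\<rho> (a (n - 1)) (a (m - 1)) < s\<^sup>2 * \<epsilon> + \<delta>"
      using close[of "n - 1" "m - n"] that by simp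
    then have "\<rho> (a (n - 1 + 1)) (a (m - 1 + 1)) \<le> \<epsilon>"
      using that by (intro mk[rule_format]) (auto simp: K_def)
    then show ?thesis using that by simp
  qed
  then show ?thesis by blast
qed

lemma orbit_Cauchy: "bvs_Cauchy \<rho> a"
  unfolding bvs_Cauchy_def
proof (rule tendstoI)
  fix e :: real assume "e > 0"
  then obtain K where K: "\<And>n m. n \<ge> K \<Longrightarrow> m > n \<Longrightarrow> \<rho> (a n) (a m) \<le> e / 2"
    using orbit_uniformly_close[of "e / 2"] by auto
  have sym: "\<rho> (a n) (a m) = \<rho> (a m) (a n)" and refl: "\<rho> (a n) (a n) = 0" for n m
    using space orbit_in by (auto simp: bvs_metric_space_def)
  have "\<rho> (a n) (a m) < e" if "n \<ge> K" "m \<ge> K" for n m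
    using K[of n m] K[of m n] sym[of n m] refl[of n] that \<open>e > 0\<close>
    by (cases n m rule: linorder_cases) auto
  then have "\<forall>n\<ge>K. \<forall>m\<ge>K. dist (case (n, m) of (n, m) \<Rightarrow> \<rho> (a n) (a m)) 0 < e"
    using dist_nonneg by simp
  then show "\<forall>\<^sub>F p in sequentially \<times>\<^sub>F sequentially.
      dist (case p of (n, m) \<Rightarrow> \<rho> (a n) (a m)) 0 < e"
    unfolding eventually_prod_sequentially by blast
qed

lemma orbit_converges_to_fixed_point:
  assumes complete: "bvs_complete X \<rho>" and orb_cont: "orbitally_continuous X \<rho> T"
  shows "\<exists>u\<in>X. T u = u \<and> bvs_converges \<rho> a u"
proof -
  obtain u where u: "u \<in> X" "bvs_converges \<rho> a u"
    using complete[unfolded bvs_complete_def, rule_format, of a] orbit_Cauchy orbit_in by auto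
  have "bvs_converges \<rho> (\<lambda>k. a (Suc k)) u"
    using u(2) unfolding bvs_converges_def by (rule LIMSEQ_Suc)
  moreover have "bvs_converges \<rho> (\<lambda>k. a (Suc k)) (T u)"
    using orb_cont[unfolded orbitally_continuous_def, rule_format, of x u "\<lambda>k. k"] u x
    by (simp add: strict_mono_def)
  moreover have "inj (\<lambda>k. a (Suc k))"
    using inj_compose[OF orbit_inj inj_Suc] by (simp add: o_def)
  moreover have "(\<lambda>k. \<rho> (a (Suc k)) (a (Suc (Suc k)))) \<longlonglongrightarrow> 0"
    using LIMSEQ_Suc[OF gap_tendsto_0[of 1]] by simp
  moreover have "range (\<lambda>k. a (Suc k)) \<subseteq> X" "T u \<in> X"
    using orbit_in u self_map by blast+
  ultimately have "T u = u"
    using limit_unique[OF space, of "\<lambda>k. a (Suc k)" "T u" u] u(1) by blast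
  then show ?thesis using u by blast
qed

end

section \<open>The fixed point theorem\<close>

theorem theorem2p11:
  fixes X :: "'a set" and \<rho> :: "'a \<Rightarrow> 'a \<Rightarrow> real" and v :: nat and s :: real
    and T :: "'a \<Rightarrow> 'a"
  assumes space: "bvs_metric_space X \<rho> v s"
    and complete: "bvs_complete X \<rho>"
    and self_map: "T ` X \<subseteq> X"
    and orb_cont: "orbitally_continuous X \<rho> T"
    and contractive: "\<And>x y. x \<in> X \<Longrightarrow> y \<in> X \<Longrightarrow> x \<noteq> y \<Longrightarrow>
          \<rho> (T x) (T y) < Max {\<rho> x y, \<rho> x (T x), \<rho> y (T y)}"
    and meir_keeler: "\<And>x \<epsilon>. x \<in> X \<Longrightarrow> \<epsilon> > 0 \<Longrightarrow>
          \<exists>\<delta>>0. \<exists>N::nat. \<forall>n\<ge>N. \<forall>m\<ge>N.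
            \<rho> ((T ^^ n) x) ((T ^^ m) x) < s\<^sup>2 * \<epsilon> + \<delta> \<longrightarrow>
            \<rho> ((T ^^ (n + 1)) x) ((T ^^ (m + 1)) x) \<le> \<epsilon>"
  shows "\<exists>u\<in>X. T u = u \<and> (\<forall>w\<in>X. T w = w \<longrightarrow> w = u) \<and>
           (\<forall>x\<in>X. bvs_converges \<rho> (\<lambda>n. (T ^^ n) x) u)"
proof -
  have refl: "\<rho> y y = 0" and nonneg: "\<rho> y z \<ge> 0" if "y \<in> X" "z \<in> X" for y z
    using space that by (auto simp: bvs_metric_space_def)
  have limit: "\<exists>u\<in>X. T u = u \<and> bvs_converges \<rho> (\<lambda>n. (T ^^ n) x) u" if x: "x \<in> X" for x
  proof (cases "\<exists>n. T ((T ^^ n) x) = (T ^^ n) x")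
    case True
    then obtain n where n: "T ((T ^^ n) x) = (T ^^ n) x" by blast
    have "(T ^^ n) x \<in> X" using self_map x by (induction n) auto
    have "(T ^^ (k + n)) x = (T ^^ n) x" for k using n by (induction k) auto
    then have "(\<lambda>k. \<rho> ((T ^^ (k + n)) x) ((T ^^ n) x)) \<longlonglongrightarrow> 0"
      using refl \<open>(T ^^ n) x \<in> X\<close> by simp
    then have "bvs_converges \<rho> (\<lambda>k. (T ^^ k) x) ((T ^^ n) x)"
      unfolding bvs_converges_def by (rule LIMSEQ_offset)
    then show ?thesis using n \<open>(T ^^ n) x \<in> X\<close> by blast
  next
    case False
    interpret moving_orbit X \<rho> v s T x
      using space self_map x contractive meir_keeler[OF x] False
      by unfold_locales auto
    show ?thesis using orbit_converges_to_fixed_point[OF complete orb_cont] .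
  qed
  have unique: "w = u" if "u \<in> X" "w \<in> X" "T u = u" "T w = w" for u w
    using contractive[OF that(2,1)] that refl nonneg[OF that(2,1)] by auto
  obtain x where "x \<in> X" using space by (auto simp: bvs_metric_space_def)
  then obtain u where "u \<in> X" "T u = u" using limit by blast
  moreover have "bvs_converges \<rho> (\<lambda>n. (T ^^ n) y) u" if "y \<in> X" for y
    using limit[OF that] unique calculation by blast
  ultimately show ?thesis using unique by blast
qed

end
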